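(* Suppose that $d=(d_1,\dots,d_n)$ is a finite sequence of positive integers having length $n$, maximum element $a$ and minimum element $b$. Then $d$ is bipartite graphic if $$nb\geq \begin{cases}\frac{(a+b)^2}{4} & \text{if } a\equiv b \pmod 2,\\[4pt] \left\lfloor\frac{(a+b)^2}{4}\right\rfloor & \text{otherwise,}\end{cases}\qquad( * )$$ where $\lfloor\cdot\rfloor$ denotes the integer part. Moreover, for any triple $(a,b,n)$ of positive integers with $b<a\leq n$ that fails the inequality $( * )$, there is a sequence of positive integers of length $n$ with maximal element $a$ and minimal element $b$ that is not bipartite graphic.
   Context: A finite sequence $d=(d_1,\dots,d_n)$ of positive integers is called bipartite graphic if there is a simple bipartite graph (no multiple edges) whose two parts each have $n$ vertices and each have $d$ as their list of vertex degrees. *)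

theory Defs
  imports
    Complex_Main
    "HOL-Library.Multiset"
    "HOL-Number_Theory.Cong"
    "Graph_Theory.Pair_Digraph"
begin

text \<open>
  An undirected simple graph is a \<^locale>\<open>pair_graph\<close>: a finite, loop-free, symmetric digraph
  whose arcs are pairs of vertices, so that parallel edges are excluded by the representation.
\<close>

definition bipartite_with_parts :: "'a pair_pre_digraph \<Rightarrow> 'a set \<Rightarrow> 'a set \<Rightarrow> bool" where
  "bipartite_with_parts G U V \<longleftrightarrow>
     pair_graph G \<and> pverts G = U \<union> V \<and> U \<inter> V = {} \<and> parcs G \<subseteq> U \<times> V \<union> V \<times> U"

text \<open>
  Each undirected edge is a pair of opposite arcs, so the degree of a vertex in the undirected
  sense is its out-degree.
\<close>

definition vertex_degree :: "'a pair_pre_digraph \<Rightarrow> 'a \<Rightarrow> nat" where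
  "vertex_degree G v = out_degree (with_proj G) v"

definition degree_multiset :: "'a pair_pre_digraph \<Rightarrow> 'a set \<Rightarrow> nat multiset" where
  "degree_multiset G U = image_mset (vertex_degree G) (mset_set U)"

text \<open>
  Vertices are natural numbers; every finite graph is isomorphic to one of this form.
  Degree lists are compared up to reordering, as the vertices carry no order.
\<close>

definition bipartite_graphic :: "nat list \<Rightarrow> bool" where
  "bipartite_graphic d \<longleftrightarrow>
     (\<exists>(G :: nat pair_pre_digraph) U V.
        bipartite_with_parts G U V \<and>
        card U = length d \<and> card V = length d \<and>
        degree_multiset G U = mset d \<and> degree_multiset G V = mset d)"

definition length_bound :: "nat \<Rightarrow> nat \<Rightarrow> nat \<Rightarrow> bool" where
  "length_bound a b n \<longleftrightarrow>
     real n * real b \<ge>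
       (if [a = b] (mod 2) then (real a + real b)\<^sup>2 / 4
        else of_int \<lfloor>(real a + real b)\<^sup>2 / 4\<rfloor>)"

end

theory Submission
  imports Defs
begin

text \<open>
  Both halves of the theorem compare the demand of a set of columns with what the rows can supply.

  Call \<open>r i\<close> the degrees on one side and \<open>c j\<close> those on the other. A set \<open>T\<close> of columns receives at
  most \<open>min (r i) (card T)\<close> edges from row \<open>i\<close>, so the sum of \<open>c\<close> over \<open>T\<close> cannot exceed the sum of
  these minima. The Gale--Ryser theorem (\<open>gale_ryser\<close>) says that, for equal totals, this necessary
  condition is sufficient. It is proved greedily: each row in turn is joined to the columns
  of largest remaining demand, and an exchange argument (\<open>top_subset_preserves_feasibility\<close>) shows
  that the rest of the problem still satisfies the condition.

  For \<open>r = c = d\<close> with entries between \<open>b\<close> and \<open>a\<close>, and a set of \<open>t\<close> columns, the rows indexed by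
  \<open>T\<close> itself cover its demand up to an excess of at most \<open>a - t\<close> each, and the other \<open>n - t\<close> rows
  contribute at least \<open>min b t\<close> each. It therefore suffices that \<open>t * (a - t) \<le> (n - t) * min b t\<close>
  whenever \<open>t < a\<close>. If \<open>t \<le> b\<close>, this follows from \<open>a \<le> n\<close>. Otherwise it is \<open>t * (a + b - t) \<le> n * b\<close>, and the
  largest value of the left-hand side over integers \<open>t\<close> is the integer part of \<open>(a + b)\<^sup>2 / 4\<close>.

  The same computation produces the extremal example. The maximum is attained at
  \<open>k = (a + b) div 2\<close>. If the bound fails, then in the sequence of \<open>k\<close> entries \<open>a\<close> and \<open>n - k\<close> entries \<open>b\<close>, the \<open>k\<close> vertices
  of degree \<open>a\<close> on one side would need \<open>k * a\<close> edges, more than is possible: at most \<open>k * k\<close> go to the large vertices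
  on the other side and at most \<open>(n - k) * b\<close> to the small ones.
\<close>

section \<open>Realising prescribed row and column sums\<close>

lemma exists_top_subset:
  fixes c :: "'b \<Rightarrow> int"
  assumes "finite B" "r \<le> card B"
  shows "\<exists>X\<subseteq>B. card X = r \<and> (\<forall>x\<in>X. \<forall>y\<in>B - X. c y \<le> c x)"
  using assms(2)
proof (induction r)
  case 0
  then show ?case by (intro exI[of _ "{}"]) auto
next
  case (Suc r)
  then obtain X where X: "X \<subseteq> B" "card X = r" "\<forall>x\<in>X. \<forall>y\<in>B - X. c y \<le> c x"
    by auto
  have fin: "finite (B - X)" using assms(1) by simp
  have "X \<noteq> B" using X(2) Suc.prems by auto
  with X(1) have "c ` (B - X) \<noteq> {}" by blast
  then have "Max (c ` (B - X)) \<in> c ` (B - X)"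
    using fin by (intro Max_in) auto
  then obtain m where m: "m \<in> B - X" "c m = Max (c ` (B - X))" by auto
  have m_max: "c y \<le> c m" if "y \<in> B - X" for y
    using that fin m(2) by simp
  have "finite X" using X(1) assms(1) finite_subset by blast
  then have "card (insert m X) = Suc r" using m(1) X(2) by simp
  moreover have "\<forall>x\<in>insert m X. \<forall>y\<in>B - insert m X. c y \<le> c x"
    using X(3) m_max by auto
  ultimately show ?case using X(1) m(1) by (intro exI[of _ "insert m X"]) auto
qed

text \<open>
  One greedy step: \<open>h\<close> is the capacity of the rows still to come, and the current row has just been
  assigned the columns in \<open>X\<close>. If \<open>T\<close> is comparable with \<open>X\<close>, then \<open>T\<close> contains exactly
  \<open>min (card X) (card T)\<close> columns of \<open>X\<close>, and the old condition for \<open>T\<close> gives the new one. Otherwise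
  pick \<open>x\<close> in \<open>X\<close> outside \<open>T\<close> and \<open>y\<close> in \<open>T\<close> outside \<open>X\<close>. Because \<open>c y \<le> c x\<close> and the increments of
  \<open>h\<close> decrease, either adding \<open>x\<close> to \<open>T\<close> or removing \<open>y\<close> from it does not decrease the difference
  between reduced demand and capacity; both bring \<open>T\<close> closer to \<open>X\<close>.
\<close>

lemma top_subset_preserves_feasibility:
  fixes c :: "'b \<Rightarrow> int" and h :: "nat \<Rightarrow> int"
  assumes "finite B" "X \<subseteq> B"
    and top: "\<And>x y. x \<in> X \<Longrightarrow> y \<in> B - X \<Longrightarrow> c y \<le> c x"
    and feasible: "\<And>T. T \<subseteq> B \<Longrightarrow> sum c T \<le> int (min (card X) (card T)) + h (card T)"
    and concave: "\<And>t. h (Suc (Suc t)) - h (Suc t) \<le> h (Suc t) - h t"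
    and "T \<subseteq> B"
  shows "(\<Sum>j\<in>T. c j - of_bool (j \<in> X)) \<le> h (card T)"
  using \<open>T \<subseteq> B\<close>
proof (induction "card (T - X) + card (X - T)" arbitrary: T rule: less_induct)
  case less
  have finT: "finite T" and finX: "finite X"
    using less.prems assms(1,2) finite_subset by blast+
  have split: "(\<Sum>j\<in>T. c j - of_bool (j \<in> X)) = sum c T - int (card (T \<inter> X))"
    using finT by (simp add: sum_subtractf Int_def)
  consider "X \<subseteq> T" | "T \<subseteq> X" | x y where "x \<in> X - T" "y \<in> T - X" by blast
  then show ?case
  proof cases
    case 1
    then have "T \<inter> X = X" "card X \<le> card T" using finT by (auto intro: card_mono)
    then show ?thesis using feasible[OF less.prems] split by simp
  next
    case 2
    then have "T \<inter> X = T" "card T \<le> card X" using finX by (auto intro: card_mono)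
    then show ?thesis using feasible[OF less.prems] split by simp
  next
    case 3
    define t where "t = card T - 1"
    have cardT: "card T = Suc t"
      using 3(2) finT unfolding t_def by (metis Diff_iff Suc_pred' card_gt_0_iff empty_iff)
    have cx: "c y \<le> c x" using top 3 less.prems by blast
    show ?thesis
    proof (cases "c x - 1 \<ge> h (Suc (Suc t)) - h (Suc t)")
      case True
      have "insert x T - X = T - X" "X - insert x T = (X - T) - {x}" using 3 by auto
      moreover have "card ((X - T) - {x}) < card (X - T)"
        using 3(1) finX by (intro card_Diff1_less) auto
      ultimately have "card (insert x T - X) + card (X - insert x T) < card (T - X) + card (X - T)"
        by (simp only: add_less_cancel_left)
      moreover have "insert x T \<subseteq> B" using 3 less.prems assms(2) by auto
      ultimately have "(\<Sum>j\<in>insert x T. c j - of_bool (j \<in> X)) \<le> h (card (insert x T))"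
        by (rule less.hyps)
      moreover have "card (insert x T) = Suc (Suc t)" using cardT finT 3 by simp
      ultimately show ?thesis using True finT 3 cardT by simp
    next
      case False
      have "(T - {y}) - X = (T - X) - {y}" "X - (T - {y}) = X - T" using 3 by auto
      moreover have "card ((T - X) - {y}) < card (T - X)"
        using 3(2) finT by (intro card_Diff1_less) auto
      ultimately have "card ((T - {y}) - X) + card (X - (T - {y})) < card (T - X) + card (X - T)"
        by (simp only: add_less_cancel_right)
      moreover have "T - {y} \<subseteq> B" using less.prems by auto
      ultimately have "(\<Sum>j\<in>T - {y}. c j - of_bool (j \<in> X)) \<le> h (card (T - {y}))"
        by (rule less.hyps)
      moreover have "card (T - {y}) = t" using cardT finT 3 by simp
      moreover have "(\<Sum>j\<in>T. c j - of_bool (j \<in> X))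
          = (c y - of_bool (y \<in> X)) + (\<Sum>j\<in>T - {y}. c j - of_bool (j \<in> X))"
        using finT 3 by (intro sum.remove) auto
      \<comment> \<open>Demands are integers, so failure of the previous case gives \<open>c x \<le> h (t + 2) - h (t + 1)\<close>.\<close>
      moreover have "c y \<le> h (Suc t) - h t" using False cx concave[of t] by linarith
      ultimately show ?thesis using 3 cardT by simp
    qed
  qed
qed

text \<open>
  Demands are integers rather than natural numbers, so that the greedy step can always serve exactly
  \<open>r i\<close> columns. Were it to serve a column without demand, the demand would become negative; the
  condition, being preserved together with equality of the totals, rules this out at the end, when
  no rows are left.
\<close>

theorem gale_ryser:
  fixes r :: "'a \<Rightarrow> nat" and c :: "'b \<Rightarrow> int"
  assumes "finite A" "finite B"
    and "\<And>i. i \<in> A \<Longrightarrow> r i \<le> card B"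
    and "sum c B = (\<Sum>i\<in>A. int (r i))"
    and "\<And>T. T \<subseteq> B \<Longrightarrow> sum c T \<le> (\<Sum>i\<in>A. int (min (r i) (card T)))"
  shows "\<exists>N. (\<forall>i\<in>A. N i \<subseteq> B \<and> card (N i) = r i) \<and>
             (\<forall>j\<in>B. int (card {i \<in> A. j \<in> N i}) = c j)"
  using assms(1,3-)
proof (induction A arbitrary: c rule: finite_induct)
  case empty
  have "c j = 0" if "j \<in> B" for j
  proof -
    have "c j \<le> 0" "sum c (B - {j}) \<le> 0"
      using empty.prems(3)[of "{j}"] empty.prems(3)[of "B - {j}"] that by auto
    moreover have "sum c B = c j + sum c (B - {j})"
      using that assms(2) by (intro sum.remove) auto
    ultimately show ?thesis using empty.prems(2) by simp
  qed
  then show ?case by simp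
next
  case (insert i A)
  define h where "h t = (\<Sum>k\<in>A. int (min (r k) t))" for t
  obtain X where X: "X \<subseteq> B" "card X = r i" "\<forall>x\<in>X. \<forall>y\<in>B - X. c y \<le> c x"
    using exists_top_subset[OF assms(2), of "r i" c] insert.prems(1) by auto
  define c' where "c' j = c j - of_bool (j \<in> X)" for j
  \<comment> \<open>Row \<open>k\<close> adds 1 to \<open>h\<close> at each step from \<open>t\<close> to \<open>t + 1\<close> with \<open>t < r k\<close>, and 0 afterwards.\<close>
  have concave: "h (Suc (Suc t)) - h (Suc t) \<le> h (Suc t) - h t" for t
    unfolding h_def sum_subtractf[symmetric] by (rule sum_mono) (simp add: min_def)
  have feasible: "sum c T \<le> int (min (card X) (card T)) + h (card T)" if "T \<subseteq> B" for T
    using insert.prems(3)[OF that] insert.hyps X(2) by (simp add: h_def)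
  have "sum c' T \<le> (\<Sum>k\<in>A. int (min (r k) (card T)))" if "T \<subseteq> B" for T
    unfolding c'_def h_def[symmetric]
    by (rule top_subset_preserves_feasibility[OF assms(2) X(1) _ feasible concave that])
      (use X(3) in auto)
  moreover have "sum c' B = (\<Sum>k\<in>A. int (r k))"
  proof -
    have "B \<inter> X = X" using X(1) by blast
    moreover have "sum c' B = sum c B - int (card (B \<inter> X))"
      using assms(2) unfolding c'_def by (simp add: sum_subtractf Int_def)
    ultimately show ?thesis using insert.prems(2) insert.hyps X(2) by simp
  qed
  ultimately have "\<exists>N. (\<forall>k\<in>A. N k \<subseteq> B \<and> card (N k) = r k) \<and>
      (\<forall>j\<in>B. int (card {k \<in> A. j \<in> N k}) = c' j)"
    by (intro insert.IH) (simp_all add: insert.prems(1))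
  then obtain N where N: "\<forall>k\<in>A. N k \<subseteq> B \<and> card (N k) = r k"
      "\<forall>j\<in>B. int (card {k \<in> A. j \<in> N k}) = c' j"
    by (elim exE conjE)
  define N' where "N' = N(i := X)"
  have "\<forall>k\<in>insert i A. N' k \<subseteq> B \<and> card (N' k) = r k"
    using N(1) X insert.hyps by (auto simp: N'_def)
  moreover have "int (card {k \<in> insert i A. j \<in> N' k}) = c j" if "j \<in> B" for j
  proof -
    have "{k \<in> insert i A. j \<in> N' k} =
        (if j \<in> X then insert i {k \<in> A. j \<in> N k} else {k \<in> A. j \<in> N k})"
      using insert.hyps by (auto simp: N'_def)
    then show ?thesis using N(2) that insert.hyps by (auto simp: c'_def)
  qed
  ultimately show ?case by (intro exI[of _ N'] conjI ballI) auto
qed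

section \<open>Degrees in bipartite graphs\<close>

lemma vertex_degree_eq_card_neighbours: "vertex_degree G v = card {w. (v, w) \<in> parcs G}"
proof -
  have "out_arcs (with_proj G) v = Pair v ` {w. (v, w) \<in> parcs G}"
    by (auto simp: out_arcs_def)
  then show ?thesis
    by (simp add: vertex_degree_def out_degree_def card_image inj_on_def)
qed

lemma bipartite_graphicI:
  fixes d :: "nat list"
  assumes N: "\<And>i. i < length d \<Longrightarrow> N i \<subseteq> {..<length d} \<and> card (N i) = d ! i"
    and N': "\<And>j. j < length d \<Longrightarrow> card {i. i < length d \<and> j \<in> N i} = d ! j"
  shows "bipartite_graphic d"
proof -
  define n where "n = length d"
  define E where "E = {(i, n + j) | i j. i < n \<and> j \<in> N i}"
  define G :: "nat pair_pre_digraph" where "G = \<lparr>pverts = {..<2 * n}, parcs = E \<union> E\<inverse>\<rparr>"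
  have N_less: "j < n" if "i < n" "j \<in> N i" for i j
    using N that unfolding n_def by blast
  have E_sub: "E \<subseteq> {..<n} \<times> {n..<2 * n}" unfolding E_def using N_less by fastforce
  then have "finite E" by (rule finite_subset) auto
  then have "pair_graph G"
    using E_sub
    by unfold_locales (auto simp: G_def symmetric_def sym_def)
  then have bip: "bipartite_with_parts G {..<n} {n..<2 * n}"
    using E_sub unfolding bipartite_with_parts_def by (auto simp: G_def)
  have left: "vertex_degree G i = d ! i" if "i < n" for i
  proof -
    have "{w. (i, w) \<in> parcs G} = (+) n ` N i"
      using that N_less E_sub by (auto simp: G_def E_def)
    then show ?thesis using N that
      by (simp add: vertex_degree_eq_card_neighbours card_image n_def)
  qed
  have right: "vertex_degree G (n + j) = d ! j" if "j < n" for j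
  proof -
    have "{w. (n + j, w) \<in> parcs G} = {i. i < n \<and> j \<in> N i}"
      using that N_less E_sub by (auto simp: G_def E_def)
    then show ?thesis using N' that
      by (simp add: vertex_degree_eq_card_neighbours n_def)
  qed
  have mset_d: "image_mset ((!) d) (mset_set {..<n}) = mset d"
    by (metis atLeast0LessThan map_nth mset_map mset_upt n_def)
  have "degree_multiset G {..<n} = mset d"
    unfolding degree_multiset_def mset_d[symmetric] by (rule image_mset_cong) (simp add: left)
  moreover have "degree_multiset G {n..<2 * n} = mset d"
  proof -
    have "{n..<2 * n} = (+) n ` {..<n}"
      by (simp add: lessThan_atLeast0 mult_2)
    then have "mset_set {n..<2 * n} = image_mset ((+) n) (mset_set {..<n})"
      by (simp add: image_mset_mset_set)
    then have "degree_multiset G {n..<2 * n} = image_mset (\<lambda>j. vertex_degree G (n + j)) (mset_set {..<n})"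
      by (simp add: degree_multiset_def image_mset.compositionality comp_def)
    also have "\<dots> = mset d"
      unfolding mset_d[symmetric] by (rule image_mset_cong) (simp add: right)
    finally show ?thesis .
  qed
  ultimately show ?thesis
    unfolding bipartite_graphic_def using bip
    by (intro exI[of _ G] exI[of _ "{..<n}"] exI[of _ "{n..<2 * n}"]) (simp add: n_def)
qed

text \<open>
  The necessary half of the condition, in the form suited to two degree values: edges leaving \<open>S\<close>
  either end in \<open>T\<close>, where simplicity leaves room for \<open>card S * card T\<close> of them, or are counted by
  the degrees in the rest of \<open>V\<close>.
\<close>

lemma bipartite_degree_sum_le:
  assumes "bipartite_with_parts G U V" "S \<subseteq> U" "T \<subseteq> V"
  shows "(\<Sum>u\<in>S. vertex_degree G u) \<le> card S * card T + (\<Sum>v\<in>V - T. vertex_degree G v)"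
proof -
  interpret pair_graph G using assms(1) by (simp add: bipartite_with_parts_def)
  let ?E = "parcs G"
  have finUV: "finite U" "finite V" and arcs: "?E \<subseteq> U \<times> V \<union> V \<times> U" and disj: "U \<inter> V = {}"
    using assms(1) pair_finite_verts by (auto simp: bipartite_with_parts_def)
  have fin: "finite S" "finite T" "finite (V - T)" using finUV assms(2,3) finite_subset by auto
  have finN: "finite {w. (v, w) \<in> ?E}" for v
    using finite_subset[of "{w. (v, w) \<in> ?E}" "pverts G"] pair_finite_verts in_arcsD2 by blast
  have sym: "(u, v) \<in> ?E \<longleftrightarrow> (v, u) \<in> ?E" for u v
    using pair_sym_arcs by (auto simp: symmetric_def dest: symD)
  have "vertex_degree G u \<le> card T + card {v \<in> V - T. (u, v) \<in> ?E}" if "u \<in> S" for u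
  proof -
    have "{v. (u, v) \<in> ?E} \<subseteq> T \<union> {v \<in> V - T. (u, v) \<in> ?E}"
      using arcs disj that assms(2) by auto
    then have "vertex_degree G u \<le> card (T \<union> {v \<in> V - T. (u, v) \<in> ?E})"
      unfolding vertex_degree_eq_card_neighbours by (rule card_mono[rotated]) (use fin in auto)
    also have "\<dots> \<le> card T + card {v \<in> V - T. (u, v) \<in> ?E}" by (rule card_Un_le)
    finally show ?thesis .
  qed
  then have "(\<Sum>u\<in>S. vertex_degree G u) \<le> (\<Sum>u\<in>S. card T + card {v \<in> V - T. (u, v) \<in> ?E})"
    by (rule sum_mono)
  also have "\<dots> = card S * card T + (\<Sum>u\<in>S. card {v \<in> V - T. (u, v) \<in> ?E})"
    by (simp add: sum.distrib)
  also have "(\<Sum>u\<in>S. card {v \<in> V - T. (u, v) \<in> ?E}) = (\<Sum>v\<in>V - T. card {u \<in> S. (u, v) \<in> ?E})"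
    using fin by (intro sum_multicount_gen) auto
  also have "\<dots> \<le> (\<Sum>v\<in>V - T. vertex_degree G v)"
    unfolding vertex_degree_eq_card_neighbours
    by (intro sum_mono card_mono finN) (auto simp: sym)
  finally show ?thesis by simp
qed

section \<open>The length bound\<close>

text \<open>
  When \<open>a\<close> and \<open>b\<close> have the same parity, \<open>(a + b)\<^sup>2\<close> is divisible by 4, so the two cases merge into a
  single inequality between natural numbers.
\<close>

lemma length_bound_iff: "length_bound a b n \<longleftrightarrow> (a + b)\<^sup>2 div 4 \<le> n * b"
proof -
  define q where "q = (a + b)\<^sup>2 div 4"
  have "length_bound a b n \<longleftrightarrow> real q \<le> real n * real b"
  proof (cases "[a = b] (mod 2)")
    case True
    then have "even (a + b)" by (metis cong_def even_add even_iff_mod_2_eq_zero)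
    then have "2\<^sup>2 dvd (a + b)\<^sup>2" by (rule dvd_power_same)
    then have "4 dvd (a + b)\<^sup>2" by simp
    then have "real q = (real a + real b)\<^sup>2 / 4"
      by (simp add: q_def real_of_nat_div)
    then show ?thesis using True by (simp only: length_bound_def if_True)
  next
    case False
    have "\<lfloor>(real a + real b)\<^sup>2 / 4\<rfloor> = int q"
      using floor_divide_of_nat_eq[of "(a + b)\<^sup>2" 4, where ?'a = real] by (simp add: q_def)
    then show ?thesis using False by (simp add: length_bound_def)
  qed
  also have "\<dots> \<longleftrightarrow> q \<le> n * b"
    by (simp only: of_nat_mult[symmetric] of_nat_le_iff)
  finally show ?thesis by (simp only: q_def)
qed

lemma mult_diff_le_square_div_4:
  fixes k s :: nat
  assumes "k \<le> s"
  shows "k * (s - k) \<le> s\<^sup>2 div 4"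
proof -
  obtain m where s: "s = k + m" using assms le_Suc_ex by blast
  have "4 * (real k * real m) \<le> (real k + real m)\<^sup>2"
    using sum_squares_bound[of "real k" "real m"] by (simp add: power2_sum)
  then have "real (4 * (k * m)) \<le> real ((k + m)\<^sup>2)" by simp
  then have "4 * (k * m) \<le> (k + m)\<^sup>2" by (simp only: of_nat_le_iff)
  then show ?thesis unfolding s by simp
qed

lemma half_mult_half_eq_square_div_4: "(s div 2) * (s - s div 2) = s\<^sup>2 div 4" for s :: nat
proof (cases "even s")
  case True
  then show ?thesis by (auto simp: power2_eq_square elim!: evenE)
next
  case False
  then obtain m where "s = 2 * m + 1" by (auto elim: oddE)
  moreover have "(2 * m + 1)\<^sup>2 = 1 + 4 * (m * (m + 1))" by (simp add: power2_eq_square)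
  ultimately show ?thesis by simp
qed

lemma length_bound_imp_le:
  assumes "0 < b" "b \<le> a" "length_bound a b n"
  shows "a \<le> n"
proof -
  have "a * b \<le> (a + b)\<^sup>2 div 4" using mult_diff_le_square_div_4[of a "a + b"] by simp
  also have "\<dots> \<le> n * b" using assms(3) by (simp add: length_bound_iff)
  finally show ?thesis using assms(1) by simp
qed

section \<open>Sufficiency and sharpness\<close>

theorem bipartite_graphic_if_length_bound:
  assumes "d \<noteq> []" "\<forall>x\<in>set d. 0 < x"
    and bound: "length_bound (Max (set d)) (Min (set d)) (length d)"
  shows "bipartite_graphic d"
proof -
  define n a b where "n = length d" and "a = Max (set d)" and "b = Min (set d)"
  have range: "b \<le> d ! i" "d ! i \<le> a" if "i < n" for i
    using that by (auto simp: n_def a_def b_def)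
  have "b \<in> set d" using assms(1) by (simp add: b_def)
  then have "0 < b" "b \<le> a" using assms(2) by (auto simp: a_def)
  then have "a \<le> n" using bound length_bound_imp_le by (simp add: n_def a_def b_def)
  \<comment> \<open>The excess demand of \<open>t\<close> columns against the guaranteed supply of the other \<open>n - t\<close> rows.\<close>
  have excess_le: "t * (a - t) \<le> (n - t) * min b t" if "t < a" for t
  proof (cases "t \<le> b")
    case True
    then show ?thesis using \<open>a \<le> n\<close> by (simp add: min_absorb2 mult.commute diff_le_mono)
  next
    case False
    have "t * (a + b - t) \<le> n * b"
      using mult_diff_le_square_div_4[of t "a + b"] bound that
      by (simp add: length_bound_iff n_def a_def b_def)
    moreover have "t * (a + b - t) = t * (a - t) + t * b"
      using that by (simp add: distrib_left[symmetric])
    ultimately have "t * (a - t) \<le> n * b - t * b" by simp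
    then show ?thesis using False by (simp add: diff_mult_distrib min_absorb1)
  qed
  have feasible: "(\<Sum>j\<in>T. d ! j) \<le> (\<Sum>i<n. min (d ! i) (card T))" if T: "T \<subseteq> {..<n}" for T
  proof -
    let ?t = "card T"
    have finT: "finite T" using T finite_subset by blast
    have split: "(\<Sum>i<n. min (d ! i) ?t) = (\<Sum>i\<in>T. min (d ! i) ?t) + (\<Sum>i\<in>{..<n} - T. min (d ! i) ?t)"
      using sum.subset_diff[OF T, of "\<lambda>i. min (d ! i) ?t"] by simp
    show ?thesis
    proof (cases "a \<le> ?t")
      case True
      then have "min (d ! i) ?t = d ! i" if "i \<in> T" for i
        using range(2)[of i] that T by (auto simp: min_def)
      then show ?thesis unfolding split by simp
    next
      case False
      have "(\<Sum>j\<in>T. d ! j) \<le> (\<Sum>j\<in>T. min (d ! j) ?t + (a - ?t))"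
      proof (rule sum_mono)
        fix j assume "j \<in> T"
        then have "d ! j \<le> a" using T range by auto
        then show "d ! j \<le> min (d ! j) ?t + (a - ?t)" by linarith
      qed
      also have "\<dots> = (\<Sum>j\<in>T. min (d ! j) ?t) + ?t * (a - ?t)"
        by (simp add: sum.distrib)
      also have "?t * (a - ?t) \<le> (n - ?t) * min b ?t" using excess_le False by simp
      also have "(n - ?t) * min b ?t = (\<Sum>i\<in>{..<n} - T. min b ?t)"
        using T finT by (simp add: card_Diff_subset)
      also have "\<dots> \<le> (\<Sum>i\<in>{..<n} - T. min (d ! i) ?t)"
        using range by (intro sum_mono min.mono) auto
      finally show ?thesis unfolding split by simp
    qed
  qed
  have "\<exists>N. (\<forall>i\<in>{..<n}. N i \<subseteq> {..<n} \<and> card (N i) = d ! i) \<and>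
            (\<forall>j\<in>{..<n}. int (card {i \<in> {..<n}. j \<in> N i}) = int (d ! j))"
  proof (rule gale_ryser)
    show "d ! i \<le> card {..<n}" if "i \<in> {..<n}" for i
      using range(2)[of i] that \<open>a \<le> n\<close> by simp
    show "(\<Sum>j\<in>T. int (d ! j)) \<le> (\<Sum>i<n. int (min (d ! i) (card T)))" if "T \<subseteq> {..<n}" for T
      using feasible[OF that] by (simp only: of_nat_sum[symmetric] of_nat_le_iff)
  qed auto
  then show ?thesis
    using bipartite_graphicI[of d] by (auto simp: n_def)
qed

text \<open>
  The \<open>k\<close> vertices of degree \<open>a\<close> on each side play the roles of \<open>S\<close> and \<open>T\<close> in
  \<open>bipartite_degree_sum_le\<close>; the resulting inequality \<open>k * a \<le> k * k + (n - k) * b\<close> is the negation of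
  \<open>n * b < k * (a + b - k)\<close>.
\<close>

theorem two_valued_not_bipartite_graphic:
  assumes "k \<le> n" "b < a" and gap: "n * b < k * (a + b - k)" and "k \<le> a + b"
  shows "\<not> bipartite_graphic (replicate k a @ replicate (n - k) b)" (is "\<not> bipartite_graphic ?d")
proof
  assume "bipartite_graphic ?d"
  then obtain G :: "nat pair_pre_digraph" and U V where bip: "bipartite_with_parts G U V"
    and degU: "degree_multiset G U = mset ?d" and degV: "degree_multiset G V = mset ?d"
    unfolding bipartite_graphic_def by blast
  interpret pair_graph G using bip by (simp add: bipartite_with_parts_def)
  have fin: "finite U" "finite V"
    using bip pair_finite_verts by (auto simp: bipartite_with_parts_def)
  define hi where "hi W = {w \<in> W. vertex_degree G w = a}" for W
  have card_hi: "card (hi W) = k" if "finite W" "degree_multiset G W = mset ?d" for W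
  proof -
    have "count (degree_multiset G W) a = (\<Sum>w\<in>hi W. count (mset_set W) w)"
      using that(1) unfolding degree_multiset_def count_image_mset'
      by (intro sum.cong) (auto simp: hi_def)
    also have "\<dots> = card (hi W)" using that(1) by (simp add: hi_def)
    finally show ?thesis using that(2) assms(2) by simp
  qed
  have "(\<Sum>v\<in>V. vertex_degree G v) = sum_list ?d"
    using degV by (metis degree_multiset_def sum_mset_sum_list sum_unfold_sum_mset)
  then have sumV: "(\<Sum>v\<in>V. vertex_degree G v) = k * a + (n - k) * b"
    by (simp add: sum_list_replicate)
  moreover have "(\<Sum>v\<in>V. vertex_degree G v)
      = (\<Sum>v\<in>V - hi V. vertex_degree G v) + (\<Sum>v\<in>hi V. vertex_degree G v)"
    using fin by (intro sum.subset_diff) (auto simp: hi_def)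
  moreover have sum_hi: "(\<Sum>w\<in>hi W. vertex_degree G w) = card (hi W) * a" for W
    by (simp add: hi_def)
  ultimately have low: "(\<Sum>v\<in>V - hi V. vertex_degree G v) = (n - k) * b"
    using card_hi[OF fin(2) degV] by simp
  have "(\<Sum>u\<in>hi U. vertex_degree G u)
      \<le> card (hi U) * card (hi V) + (\<Sum>v\<in>V - hi V. vertex_degree G v)"
    by (rule bipartite_degree_sum_le[OF bip]) (auto simp: hi_def)
  then have "k * a \<le> k * k + (n - k) * b"
    unfolding sum_hi low card_hi[OF fin(1) degU] card_hi[OF fin(2) degV] .
  moreover have "n * b = (n - k) * b + k * b"
    using assms(1) by (simp add: add_mult_distrib[symmetric])
  moreover have "k * (a + b - k) + k * k = k * a + k * b"
    using assms(4) by (simp add: distrib_left[symmetric])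
  ultimately show False using gap by linarith
qed

theorem theorem3:
  shows "(\<forall>(d :: nat list) (n :: nat) (a :: nat) (b :: nat).
            d \<noteq> [] \<and> (\<forall>x\<in>set d. 0 < x) \<and>
            length d = n \<and> Max (set d) = a \<and> Min (set d) = b \<and>
            length_bound a b n \<longrightarrow> bipartite_graphic d) \<and>
         (\<forall>(a :: nat) (b :: nat) (n :: nat).
            0 < a \<and> 0 < b \<and> 0 < n \<and> b < a \<and> a \<le> n \<and> \<not> length_bound a b n \<longrightarrow>
            (\<exists>d :: nat list.
               (\<forall>x\<in>set d. 0 < x) \<and> length d = n \<and>
               Max (set d) = a \<and> Min (set d) = b \<and> \<not> bipartite_graphic d))"
proof (intro conjI allI impI)
  fix d :: "nat list" and n a b :: nat
  assume "d \<noteq> [] \<and> (\<forall>x\<in>set d. 0 < x) \<and> length d = n \<and> Max (set d) = a \<and> Min (set d) = b \<and>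
    length_bound a b n"
  then show "bipartite_graphic d" using bipartite_graphic_if_length_bound by blast
next
  fix a b n :: nat
  assume *: "0 < a \<and> 0 < b \<and> 0 < n \<and> b < a \<and> a \<le> n \<and> \<not> length_bound a b n"
  \<comment> \<open>This value maximises \<open>k * (a + b - k)\<close>; as \<open>b < a\<close>, it leaves at least one entry of each kind.\<close>
  define k where "k = (a + b) div 2"
  define d where "d = replicate k a @ replicate (n - k) b"
  have k: "0 < k" "k < n" "k \<le> a + b" using * by (auto simp: k_def)
  have set_d: "set d = {a, b}" using k by (auto simp: d_def)
  have "n * b < k * (a + b - k)"
    using * by (simp add: length_bound_iff k_def half_mult_half_eq_square_div_4)
  then have "\<not> bipartite_graphic d"
    unfolding d_def using k * by (intro two_valued_not_bipartite_graphic) auto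
  moreover have "length d = n" using k by (simp add: d_def)
  ultimately show "\<exists>d :: nat list. (\<forall>x\<in>set d. 0 < x) \<and> length d = n \<and>
      Max (set d) = a \<and> Min (set d) = b \<and> \<not> bipartite_graphic d"
    using * set_d by (intro exI[of _ d]) auto
qed

end
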